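(* Let $\varphi\in ZL_0^2(NF^{n,n+1},NF^{n,n+1})$ be any even 2-cocycle. Then there are scalars $\alpha_{j,k}$ ($1\le j\le n+1$, $1\le k\le n$) and $\beta_{j,k}$ ($1\le j\le n$, $1\le k\le n+1$, $(j,k)\neq(n,1)$) in $F$ such that $\varphi$ has the following form (values on pairs of basis elements not listed being zero): $$\begin{cases} \varphi(y_j,y_1)=\sum_{k=1}^n\alpha_{j,k}x_k, & 1\le j\le n+1,\\ \varphi(x_j,y_1)=\sum_{k=1}^{n+1}\beta_{j,k}y_k, & 1\le j\le n-1,\\ \varphi(x_n,y_1)=-\frac{\alpha_{n+1,1}}2y_1+\sum_{k=2}^{n+1}\beta_{n,k}y_k, &\\ \varphi(x_j,x_1)=-\alpha_{1,1}x_{j+1}+\sum_{k=1}^n(\alpha_{j+1,k}+2\beta_{j,k})x_k, & 1\le j\le n-1,\\ \varphi(x_n,x_1)=\sum_{k=2}^n(\alpha_{n+1,k}+2\beta_{n,k})x_k, &\\ \varphi(y_j,x_1)=2\beta_{j,1}y_1-\alpha_{1,1}y_{j+1}+\sum_{k=2}^{n+1}(\alpha_{j,k-1}+2\beta_{j,k})y_k, & 1\le j\le n-1,\\ \varphi(y_n,x_1)=-\alpha_{n+1,1}y_1-\alpha_{1,1}y_{n+1}+\sum_{k=2}^{n+1}(\alpha_{n,k-1}+2\beta_{n,k})y_k, &\\ \varphi(y_{n+1},x_1)=\sum_{k=2}^{n+1}\alpha_{n+1,k-1}y_k, &\\ \varphi(x_i,x_{j+1})=-(\alpha_{j+1,1}+2\beta_{j,1})x_{i+1},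 & 1\le i\le n-1,\ 1\le j\le n-1,\\ \varphi(y_i,x_{j+1})=-(\alpha_{j+1,1}+2\beta_{j,1})y_{i+1}, & 1\le i\le n,\ 1\le j\le n-1,\\ \varphi(x_i,y_{j+1})=-\beta_{j,1}y_{i+1}, & 1\le i\le n,\ 1\le j\le n-1,\\ \varphi(x_i,y_{n+1})=-\frac{\alpha_{n+1,1}}2y_{i+1}, & 1\le i\le n,\\ \varphi(y_i,y_{j+1})=-2\beta_{j,1}x_i, & 1\le i\le n,\ 1\le j\le n-1,\\ \varphi(y_i,y_{n+1})=-\alpha_{n+1,1}x_i, & 1\le i\le n. \end{cases}$$
   Context: $F$ is a field of characteristic zero. $NF^{n,n+1}$ is the Leibniz superalgebra with even basis $x_1,\dots,x_n$, odd basis $y_1,\dots,y_{n+1}$ and products $[y_i,y_1]=x_i$, $[x_i,y_1]=\frac12y_{i+1}$, $[y_i,x_1]=y_{i+1}$ ($1\le i\le n$), $[x_i,x_1]=x_{i+1}$ ($1\le i\le n-1$), all other products of basis elements being zero. For a Leibniz superalgebra $L=L_0\oplus L_1$ (a $\mathbb Z_2$-graded algebra with $[x,[y,z]]=[[x,y],z]-(-1)^{|y||z|}[[x,z],y]$), the space $ZL_0^2(L,L)$ of even 2-cocycles (infinitesimal deformations) consists of the bilinear maps $\varphi:L\times L\to L$ with $\varphi(L_a,L_b)\subseteq L_{a+b}$ such that for all homogeneous $x,y,z\in L$ $$[x,\varphi(y,z)]-[\varphi(x,y),z]+(-1)^{|y||z|}[\varphi(x,z),y]+\varphi(x,[y,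z])-\varphi([x,y],z)+(-1)^{|y||z|}\varphi([x,z],y)=0.$$
   Formalization: Two signs are corrected: φ(x_i,y_{n+1}) = +(α_{n+1,1}/2) y_{i+1} and φ(y_i,y_{n+1}) = +α_{n+1,1} x_i; the printed minus signs contradict the cocycle identity whenever α_{n+1,1} ≠ 0 (already for n = 1). *)

theory Defs
  imports Complex_Main "HOL-Library.Function_Algebras" "HOL-Library.Z2"
begin

text \<open>
  A superalgebra is given by its two homogeneous parts \<open>L 0\<close> and \<open>L 1\<close>, subspaces of an ambient
  vector space meeting only in 0; degrees are elements of the two-element field \<open>bit\<close>. The algebra
  itself is \<open>super_carrier L\<close>. Maps on it are total functions of which only the values on
  the carrier matter.
\<close>

definition super_carrier :: "(bit \<Rightarrow> 'v::ab_group_add set) \<Rightarrow> 'v set" where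
  "super_carrier L = {u + v |u v. u \<in> L 0 \<and> v \<in> L 1}"

definition bilinear_on :: "('f \<Rightarrow> 'v::ab_group_add \<Rightarrow> 'v) \<Rightarrow> 'v set \<Rightarrow> ('v \<Rightarrow> 'v \<Rightarrow> 'v) \<Rightarrow> bool" where
  "bilinear_on scale V h \<longleftrightarrow>
     (\<forall>u\<in>V. \<forall>v\<in>V. \<forall>w\<in>V. h (u + v) w = h u w + h v w \<and> h w (u + v) = h w u + h w v) \<and>
     (\<forall>c. \<forall>u\<in>V. \<forall>v\<in>V. h (scale c u) v = scale c (h u v) \<and> h u (scale c v) = scale c (h u v))"

definition even_map :: "(bit \<Rightarrow> 'v set) \<Rightarrow> ('v \<Rightarrow> 'v \<Rightarrow> 'v) \<Rightarrow> bool" where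
  "even_map L h \<longleftrightarrow> (\<forall>a b. \<forall>u\<in>L a. \<forall>v\<in>L b. h u v \<in> L (a + b))"

definition super_sign :: "bit \<Rightarrow> bit \<Rightarrow> 'f::field" where
  "super_sign a b = (if a = 1 \<and> b = 1 then -1 else 1)"

locale leibniz_superalgebra = vector_space scale
  for scale :: "'f::field \<Rightarrow> 'v::ab_group_add \<Rightarrow> 'v"
  and L :: "bit \<Rightarrow> 'v set"
  and br :: "'v \<Rightarrow> 'v \<Rightarrow> 'v" +
  assumes subspace_part: "subspace (L a)"
    and parts_disjoint: "L 0 \<inter> L 1 = {0}"
    and bilinear_br: "bilinear_on scale (super_carrier L) br"
    and even_br: "even_map L br"
    and leibniz: "\<lbrakk>x \<in> L a; y \<in> L b; z \<in> L c\<rbrakk> \<Longrightarrow>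
      br x (br y z) = br (br x y) z - scale (super_sign b c) (br (br x z) y)"

definition even_2cocycles ::
  "('f::field \<Rightarrow> 'v::ab_group_add \<Rightarrow> 'v) \<Rightarrow> (bit \<Rightarrow> 'v set) \<Rightarrow> ('v \<Rightarrow> 'v \<Rightarrow> 'v) \<Rightarrow> ('v \<Rightarrow> 'v \<Rightarrow> 'v) set" where
  "even_2cocycles scale L br =
     {\<phi>. bilinear_on scale (super_carrier L) \<phi> \<and> even_map L \<phi> \<and>
        (\<forall>a b c. \<forall>x\<in>L a. \<forall>y\<in>L b. \<forall>z\<in>L c.
           br x (\<phi> y z) - br (\<phi> x y) z + scale (super_sign b c) (br (\<phi> x z) y)
         + \<phi> x (br y z) - \<phi> (br x y) z + scale (super_sign b c) (\<phi> (br x z) y) = 0)}"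

text \<open>
  The superalgebra \<open>NF\<^sup>n\<^sup>,\<^sup>n\<^sup>+\<^sup>1\<close>: vectors are coordinate functions on the labels \<open>X i\<close>, \<open>Y i\<close>
  (with the pointwise addition of \<open>Function_Algebras\<close>) that vanish outside
  \<open>X 1, \<dots>, X n, Y 1, \<dots>, Y (n + 1)\<close>.
\<close>

datatype nf_label = X nat | Y nat

type_synonym 'f nf_vec = "nf_label \<Rightarrow> 'f"

definition nf_scale :: "'f::field \<Rightarrow> 'f nf_vec \<Rightarrow> 'f nf_vec" (infixr \<open>\<odot>\<close> 75) where
  "c \<odot> v = (\<lambda>l. c * v l)"

definition nf_unit :: "nf_label \<Rightarrow> 'f::field nf_vec" where
  "nf_unit l = (\<lambda>m. if m = l then 1 else 0)"

abbreviation vx :: "nat \<Rightarrow> 'f::field nf_vec" where "vx i \<equiv> nf_unit (X i)"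
abbreviation vy :: "nat \<Rightarrow> 'f::field nf_vec" where "vy i \<equiv> nf_unit (Y i)"

definition nf_labels :: "nat \<Rightarrow> bit \<Rightarrow> nf_label set" where
  "nf_labels n a = (if a = 0 then X ` {1..n} else Y ` {1..n+1})"

definition nf_part :: "nat \<Rightarrow> bit \<Rightarrow> 'f::field nf_vec set" where
  "nf_part n a = {v. \<forall>l. l \<notin> nf_labels n a \<longrightarrow> v l = 0}"

fun nf_mult :: "nat \<Rightarrow> nf_label \<Rightarrow> nf_label \<Rightarrow> 'f::field nf_vec" where
  "nf_mult n (Y i) (Y j) = (if j = 1 \<and> 1 \<le> i \<and> i \<le> n then vx i else 0)"
| "nf_mult n (X i) (Y j) = (if j = 1 \<and> 1 \<le> i \<and> i \<le> n then (1/2) \<odot> vy (i+1) else 0)"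
| "nf_mult n (Y i) (X j) = (if j = 1 \<and> 1 \<le> i \<and> i \<le> n then vy (i+1) else 0)"
| "nf_mult n (X i) (X j) = (if j = 1 \<and> 1 \<le> i \<and> i \<le> n - 1 then vx (i+1) else 0)"

definition nf_bracket :: "nat \<Rightarrow> 'f::field nf_vec \<Rightarrow> 'f nf_vec \<Rightarrow> 'f nf_vec" where
  "nf_bracket n u v = (\<Sum>p\<in>nf_labels n 0 \<union> nf_labels n 1. \<Sum>q\<in>nf_labels n 0 \<union> nf_labels n 1.
     (u p * v q) \<odot> nf_mult n p q)"

interpretation nf: vector_space nf_scale
  by unfold_locales (auto simp: nf_scale_def fun_eq_iff algebra_simps)

lemma nf_sum_labels:
  "(\<Sum>p\<in>nf_labels n 0 \<union> nf_labels n 1. g p) = (\<Sum>i=1..n. g (X i)) + (\<Sum>i=1..n+1. g (Y i))"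
  for g :: "nf_label \<Rightarrow> 'b::comm_monoid_add"
proof -
  have "(\<Sum>p\<in>nf_labels n 0 \<union> nf_labels n 1. g p)
      = (\<Sum>p\<in>X ` {1..n}. g p) + (\<Sum>p\<in>Y ` {1..n+1}. g p)"
    unfolding nf_labels_def by (subst sum.union_disjoint) auto
  also have "(\<Sum>p\<in>X ` {1..n}. g p) = (\<Sum>i=1..n. g (X i))"
    by (subst sum.reindex) (auto simp: inj_on_def)
  also have "(\<Sum>p\<in>Y ` {1..n+1}. g p) = (\<Sum>i=1..n+1. g (Y i))"
    by (subst sum.reindex) (auto simp: inj_on_def)
  finally show ?thesis .
qed

lemma nf_sum_apply: "(\<Sum>i\<in>A. h i) l = (\<Sum>i\<in>A. h i l)"
  for h :: "'i \<Rightarrow> nf_label \<Rightarrow> 'b::comm_monoid_add"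
  by (induction A rule: infinite_finite_induct) auto

lemma nf_bracket_apply:
  fixes u v :: "'f::field nf_vec"
  assumes "1 \<le> n"
  shows "nf_bracket n u v l =
    (\<Sum>i=1..n. u (X i) * v (X 1) * nf_mult n (X i) (X 1) l + u (X i) * v (Y 1) * nf_mult n (X i) (Y 1) l)
  + (\<Sum>i=1..n+1. u (Y i) * v (X 1) * nf_mult n (Y i) (X 1) l + u (Y i) * v (Y 1) * nf_mult n (Y i) (Y 1) l)"
proof -
  have *: "(\<Sum>q\<in>nf_labels n 0 \<union> nf_labels n 1. u p * v q * nf_mult n p q l)
     = u p * v (X 1) * nf_mult n p (X 1) l + u p * v (Y 1) * nf_mult n p (Y 1) l" for p
  proof -
    have a: "(\<Sum>i=1..n. u p * v (X i) * nf_mult n p (X i) l) = (\<Sum>i\<in>{1}. u p * v (X i) * nf_mult n p (X i) l)"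
      using assms by (intro sum.mono_neutral_right) (cases p; auto)+
    have b: "(\<Sum>i=1..n+1. u p * v (Y i) * nf_mult n p (Y i) l) = (\<Sum>i\<in>{1}. u p * v (Y i) * nf_mult n p (Y i) l)"
      using assms by (intro sum.mono_neutral_right) (cases p; auto)+
    show ?thesis unfolding nf_sum_labels a b by simp
  qed
  show ?thesis
    unfolding nf_bracket_def nf_sum_apply nf_scale_def * by (rule nf_sum_labels)
qed

lemma nf_bracket_X:
  fixes u v :: "'f::field nf_vec"
  assumes n: "1 \<le> n"
  shows "nf_bracket n u v (X k) = (if 1 \<le> k \<and> k \<le> n then u (Y k) * v (Y 1) else 0)
       + (if 2 \<le> k \<and> k \<le> n then u (X (k - 1)) * v (X 1) else 0)"
proof -
  have "(\<Sum>i=1..n. u (X i) * v (X 1) * nf_mult n (X i) (X 1) (X k) + u (X i) * v (Y 1) * nf_mult n (X i) (Y 1) (X k))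
      = (\<Sum>i=1..n. if i = k - 1 then if 2 \<le> k \<and> k \<le> n then u (X i) * v (X 1) else 0 else 0)"
    by (intro sum.cong) (auto simp: nf_unit_def nf_scale_def)
  moreover have "(\<Sum>i=1..n+1. u (Y i) * v (X 1) * nf_mult n (Y i) (X 1) (X k) + u (Y i) * v (Y 1) * nf_mult n (Y i) (Y 1) (X k))
      = (\<Sum>i=1..n+1. if i = k then if 1 \<le> k \<and> k \<le> n then u (Y i) * v (Y 1) else 0 else 0)"
    by (intro sum.cong) (auto simp: nf_unit_def nf_scale_def)
  ultimately show ?thesis
    unfolding nf_bracket_apply[OF n] by (auto simp: sum.delta)
qed

lemma nf_bracket_Y:
  fixes u v :: "'f::field nf_vec"
  assumes n: "1 \<le> n"
  shows "nf_bracket n u v (Y k) = (if 2 \<le> k \<and> k \<le> n + 1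
       then 1/2 * u (X (k - 1)) * v (Y 1) + u (Y (k - 1)) * v (X 1) else 0)"
proof -
  have "(\<Sum>i=1..n. u (X i) * v (X 1) * nf_mult n (X i) (X 1) (Y k) + u (X i) * v (Y 1) * nf_mult n (X i) (Y 1) (Y k))
      = (\<Sum>i=1..n. if i = k - 1 then if 2 \<le> k \<and> k \<le> n + 1 then 1/2 * u (X i) * v (Y 1) else 0 else 0)"
    by (intro sum.cong) (auto simp: nf_unit_def nf_scale_def)
  moreover have "(\<Sum>i=1..n+1. u (Y i) * v (X 1) * nf_mult n (Y i) (X 1) (Y k) + u (Y i) * v (Y 1) * nf_mult n (Y i) (Y 1) (Y k))
      = (\<Sum>i=1..n+1. if i = k - 1 then if 2 \<le> k \<and> k \<le> n + 1 then u (Y i) * v (X 1) else 0 else 0)"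
    by (intro sum.cong) (auto simp: nf_unit_def nf_scale_def)
  ultimately show ?thesis
    unfolding nf_bracket_apply[OF n] by (auto simp: sum.delta)
qed

lemma nf_bracket_unit:
  assumes "p \<in> nf_labels n a" "q \<in> nf_labels n b"
  shows "nf_bracket n (nf_unit p) (nf_unit q) = nf_mult n p q"
proof -
  have n: "1 \<le> n" if "n = 0 \<Longrightarrow> False" using that by (cases n) auto
  let ?B = "nf_labels n 0 \<union> nf_labels n 1"
  have fin: "finite ?B" by (simp add: nf_labels_def)
  have mem: "p \<in> ?B" "q \<in> ?B"
    using assms by (auto simp: nf_labels_def split: if_splits)
  have "nf_bracket n (nf_unit p) (nf_unit q)
     = (\<Sum>p'\<in>?B. \<Sum>q'\<in>?B. if q' = q then if p' = p then nf_mult n p q else 0 else 0)"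
    unfolding nf_bracket_def
    by (intro sum.cong refl) (auto simp: nf_unit_def nf_scale_def fun_eq_iff)
  also have "\<dots> = nf_mult n p q"
    using fin mem by (simp add: sum.delta)
  finally show ?thesis .
qed

lemma nf_leibniz_superalgebra:
  assumes n: "1 \<le> n"
  shows "leibniz_superalgebra (nf_scale :: 'f::field_char_0 \<Rightarrow> _) (nf_part n) (nf_bracket n)"
proof
  have ext: "u = v" if "\<And>k. u (X k) = v (X k)" "\<And>k. u (Y k) = v (Y k)" for u v :: "'f nf_vec"
    using that by (metis ext nf_label.exhaust)
  show "nf.subspace (nf_part n a :: 'f nf_vec set)" for a
    unfolding nf.subspace_def by (auto simp: nf_part_def nf_scale_def)
  show "nf_part n 0 \<inter> nf_part n 1 = {0 :: 'f nf_vec}"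
    by (auto simp: nf_part_def nf_labels_def fun_eq_iff) (metis nf_label.exhaust nf_label.distinct(1) imageE)
  show "bilinear_on nf_scale (super_carrier (nf_part n)) (nf_bracket n :: 'f nf_vec \<Rightarrow> _)"
    unfolding bilinear_on_def
    by (auto intro!: ext simp: nf_bracket_X[OF n] nf_bracket_Y[OF n] nf_scale_def algebra_simps)
  show "even_map (nf_part n) (nf_bracket n :: 'f nf_vec \<Rightarrow> _)"
  proof -
    have "nf_bracket n u v \<in> nf_part n (a + b)" if "u \<in> nf_part n a" "v \<in> nf_part n b" for u v :: "'f nf_vec" and a b
    proof -
      have "nf_bracket n u v l = 0" if "l \<notin> nf_labels n (a + b)" for l
        using that \<open>u \<in> _\<close> \<open>v \<in> _\<close>
        by (cases l; cases a; cases b)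
          (auto simp: nf_bracket_X[OF n] nf_bracket_Y[OF n] nf_part_def nf_labels_def image_iff)
      then show ?thesis by (simp add: nf_part_def)
    qed
    then show ?thesis unfolding even_map_def by blast
  qed
  show "nf_bracket n x (nf_bracket n y z) = nf_bracket n (nf_bracket n x y) z
      - nf_scale (super_sign b c) (nf_bracket n (nf_bracket n x z) y)"
    if "x \<in> nf_part n a" "y \<in> nf_part n b" "z \<in> nf_part n c" for x y z :: "'f nf_vec" and a b c
    using that
    by (intro ext; cases b; cases c)
      (auto simp: nf_bracket_X[OF n] nf_bracket_Y[OF n] nf_part_def nf_labels_def image_iff
        nf_scale_def super_sign_def algebra_simps)
qed

end

theory Submission
  imports Defs
begin

text \<open>
  Symmetrizing the cocycle identity in its last two arguments removes the terms
  \<open>[\<phi>(x,y),z]\<close> and leaves \<open>[x, \<phi>(y,z) + s \<phi>(z,y)] + \<phi>(x, [y,z] + s [z,y]) = 0\<close>, where \<open>s\<close> is the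
  sign of \<open>(y,z)\<close>. In \<open>NF\<close> right multiplication by an element only sees its \<open>x\<^sub>1\<close> and \<open>y\<^sub>1\<close>
  coordinates. With \<open>(y,z) = (x\<^sub>j, y\<^sub>1)\<close> the identity therefore shows that \<open>\<phi>(\<cdot>, y\<^sub>j\<^sub>+\<^sub>1)\<close> is a multiple of
  right multiplication by \<open>y\<^sub>1\<close>, and with \<open>(y,z) = (y\<^sub>j, y\<^sub>1)\<close> that \<open>\<phi>(\<cdot>, x\<^sub>j)\<close>, \<open>j \<ge> 2\<close>, is a multiple
  of right multiplication by \<open>x\<^sub>1\<close>. The case \<open>j = n + 1\<close>, where \<open>[y\<^sub>j, y\<^sub>1] = 0\<close>, gives the relation
  \<open>\<beta>\<^sub>n\<^sub>,\<^sub>1 = - \<alpha>\<^sub>n\<^sub>+\<^sub>1\<^sub>,\<^sub>1 / 2\<close>. Finally \<open>\<phi>(\<cdot>, x\<^sub>1)\<close> is determined by \<open>\<phi>(\<cdot>, y\<^sub>1)\<close> through the cocycle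
  identity at \<open>(\<cdot>, y\<^sub>1, y\<^sub>1)\<close>.
\<close>

lemma (in vector_space) even_2cocycle_symmetrized:
  assumes "\<phi> \<in> even_2cocycles scale L br" "x \<in> L a" "y \<in> L b" "z \<in> L c"
  shows "br x (\<phi> y z) + scale (super_sign b c) (br x (\<phi> z y))
    + \<phi> x (br y z) + scale (super_sign b c) (\<phi> x (br z y)) = 0"
proof -
  let ?s = "super_sign b c"
  let ?d = "\<lambda>y z b c. br x (\<phi> y z) - br (\<phi> x y) z + scale (super_sign b c) (br (\<phi> x z) y)
      + \<phi> x (br y z) - \<phi> (br x y) z + scale (super_sign b c) (\<phi> (br x z) y)"
  have "?d y z b c = 0" and "?d z y c b = 0"
    using assms unfolding even_2cocycles_def by blast+
  \<comment> \<open>The sign is symmetric and squares to 1, so weighting the swapped identity by it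
    cancels every term in which \<open>x\<close> is first paired with \<open>y\<close> or
    \<open>z\<close> alone.\<close>
  then have "?d y z b c + scale ?s (?d z y c b) = 0"
    by (simp only: scale_zero_right add_0)
  then show ?thesis
    by (cases "b = 1 \<and> c = 1") (auto simp: super_sign_def algebra_simps)
qed

section \<open>Coordinates and right multiplication in \<open>NF\<close>\<close>

lemma nf_scale_apply: "(c \<odot> v) l = c * v l"
  by (simp add: nf_scale_def)

lemma nf_unit_apply: "nf_unit l m = (if m = l then 1 else 0)"
  by (simp add: nf_unit_def)

lemma nf_part_subset_carrier: "nf_part n a \<subseteq> super_carrier (nf_part n)"
proof
  fix u :: "'f::field nf_vec"
  assume "u \<in> nf_part n a"
  moreover have "(0 :: 'f nf_vec) \<in> nf_part n b" for b
    by (simp add: nf_part_def)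
  moreover have "u = u + 0" "u = 0 + u"
    by simp_all
  ultimately show "u \<in> super_carrier (nf_part n)"
    unfolding super_carrier_def by (cases a) blast+
qed

lemma vx_in_nf_part: "1 \<le> i \<Longrightarrow> i \<le> n \<Longrightarrow> vx i \<in> nf_part n 0"
  by (auto simp: nf_part_def nf_labels_def nf_unit_def)

lemma vy_in_nf_part: "1 \<le> i \<Longrightarrow> i \<le> n + 1 \<Longrightarrow> vy i \<in> nf_part n 1"
  by (auto simp: nf_part_def nf_labels_def nf_unit_def)

lemma all_nf_label: "(\<forall>l. P l) \<longleftrightarrow> (\<forall>k. P (X k)) \<and> (\<forall>k. P (Y k))"
  by (metis nf_label.exhaust)

lemma nf_part_even_iff:
  "u \<in> nf_part n 0 \<longleftrightarrow> (\<forall>k. u (Y k) = 0) \<and> (\<forall>k. k \<notin> {1..n} \<longrightarrow> u (X k) = 0)"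
  unfolding nf_part_def mem_Collect_eq by (subst all_nf_label) (auto simp: nf_labels_def image_iff)

lemma nf_part_odd_iff:
  "u \<in> nf_part n 1 \<longleftrightarrow> (\<forall>k. u (X k) = 0) \<and> (\<forall>k. k \<notin> {1..n+1} \<longrightarrow> u (Y k) = 0)"
  unfolding nf_part_def mem_Collect_eq by (subst all_nf_label) (auto simp: nf_labels_def image_iff)

lemma nf_vec_eqI: "(\<And>k. u (X k) = v (X k)) \<Longrightarrow> (\<And>k. u (Y k) = v (Y k)) \<Longrightarrow> u = v"
  by (metis ext nf_label.exhaust)

text \<open>Nonzero basis products have right factor \<open>X 1\<close> or \<open>Y 1\<close>, and
  an even \<open>w\<close> has no \<open>Y\<close> coordinates. A cocycle value in the right slot
  thus enters only through one scalar.\<close>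

lemma nf_bracket_even_right:
  assumes "1 \<le> n" "w \<in> nf_part n 0"
  shows "nf_bracket n u w = w (X 1) \<odot> nf_bracket n u (vx 1)"
  using assms
  by (intro nf_vec_eqI) (auto simp: nf_bracket_X nf_bracket_Y nf_part_even_iff nf_scale_def nf_unit_def)

lemma nf_bracket_odd_right:
  assumes "1 \<le> n" "w \<in> nf_part n 1"
  shows "nf_bracket n u w = w (Y 1) \<odot> nf_bracket n u (vy 1)"
  using assms
  by (intro nf_vec_eqI) (auto simp: nf_bracket_X nf_bracket_Y nf_part_odd_iff nf_scale_def nf_unit_def)

lemma nf_bracket_vx_vy1:
  "1 \<le> i \<Longrightarrow> i \<le> n \<Longrightarrow> nf_bracket n (vx i) (vy 1) = (1/2) \<odot> vy (i + 1)"
  by (subst nf_bracket_unit[where a = 0 and b = 1]) (auto simp: nf_labels_def)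

lemma nf_bracket_vy_vy1:
  "1 \<le> i \<Longrightarrow> i \<le> n + 1 \<Longrightarrow> nf_bracket n (vy i) (vy 1) = (if i \<le> n then vx i else 0)"
  by (subst nf_bracket_unit[where a = 1 and b = 1]) (auto simp: nf_labels_def)

lemma nf_bracket_vx_vx1:
  "1 \<le> i \<Longrightarrow> i \<le> n \<Longrightarrow> nf_bracket n (vx i) (vx 1) = (if i \<le> n - 1 then vx (i + 1) else 0)"
  by (subst nf_bracket_unit[where a = 0 and b = 0]) (auto simp: nf_labels_def)

lemma nf_bracket_vy_vx1:
  "1 \<le> n \<Longrightarrow> 1 \<le> i \<Longrightarrow> i \<le> n + 1 \<Longrightarrow>
    nf_bracket n (vy i) (vx 1) = (if i \<le> n then vy (i + 1) else 0)"
  by (subst nf_bracket_unit[where a = 1 and b = 0]) (auto simp: nf_labels_def)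

lemma sum_vx_apply:
  assumes "finite A"
  shows "(\<Sum>k\<in>A. c k \<odot> vx k) (X i) = (if i \<in> A then c i else 0)"
    and "(\<Sum>k\<in>A. c k \<odot> vx k) (Y i) = 0"
  using assms by (simp_all add: nf_sum_apply nf_scale_def nf_unit_def if_distrib sum.delta cong: if_cong)

lemma sum_vy_apply:
  assumes "finite A"
  shows "(\<Sum>k\<in>A. c k \<odot> vy k) (Y i) = (if i \<in> A then c i else 0)"
    and "(\<Sum>k\<in>A. c k \<odot> vy k) (X i) = 0"
  using assms by (simp_all add: nf_sum_apply nf_scale_def nf_unit_def if_distrib sum.delta cong: if_cong)

section \<open>Consequences of the cocycle identity for values on basis elements\<close>

context
  notes One_nat_def [simp del]
  fixes n :: nat
    and \<phi> :: "'f::field_char_0 nf_vec \<Rightarrow> 'f nf_vec \<Rightarrow> 'f nf_vec"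
  assumes n: "1 \<le> n"
    and cocycle: "\<phi> \<in> even_2cocycles nf_scale (nf_part n) (nf_bracket n)"
begin

lemma cocycle_even: "u \<in> nf_part n a \<Longrightarrow> v \<in> nf_part n b \<Longrightarrow> \<phi> u v \<in> nf_part n (a + b)"
  using cocycle unfolding even_2cocycles_def even_map_def by blast

lemma cocycle_scale:
  assumes "u \<in> nf_part n a" "v \<in> nf_part n b"
  shows "\<phi> (c \<odot> u) v = c \<odot> \<phi> u v" "\<phi> u (c \<odot> v) = c \<odot> \<phi> u v"
  using assms[THEN subsetD[OF nf_part_subset_carrier]] cocycle
  unfolding even_2cocycles_def bilinear_on_def by blast+

lemma cocycle_zero:
  assumes "u \<in> nf_part n a"
  shows "\<phi> 0 u = 0" "\<phi> u 0 = 0"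
proof -
  have "(0 :: 'f nf_vec) = 0 \<odot> 0" by simp
  moreover have "(0 :: 'f nf_vec) \<in> nf_part n 0" by (simp add: nf_part_def)
  ultimately show "\<phi> 0 u = 0" "\<phi> u 0 = 0"
    using cocycle_scale[of 0 0 u a 0] cocycle_scale[of u a 0 0 0] assms by simp_all
qed

lemma cocycle_vy_vy: "i \<in> {1..n+1} \<Longrightarrow> j \<in> {1..n+1} \<Longrightarrow> \<phi> (vy i) (vy j) \<in> nf_part n 0"
  using cocycle_even[of "vy i" 1 "vy j" 1] by (auto simp: vy_in_nf_part)

lemma cocycle_vx_vy: "i \<in> {1..n} \<Longrightarrow> j \<in> {1..n+1} \<Longrightarrow> \<phi> (vx i) (vy j) \<in> nf_part n 1"
  using cocycle_even[of "vx i" 0 "vy j" 1] by (auto simp: vy_in_nf_part vx_in_nf_part)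

lemma cocycle_vy_vx: "i \<in> {1..n+1} \<Longrightarrow> j \<in> {1..n} \<Longrightarrow> \<phi> (vy i) (vx j) \<in> nf_part n 1"
  using cocycle_even[of "vy i" 1 "vx j" 0] by (auto simp: vy_in_nf_part vx_in_nf_part)

text \<open>At \<open>(u, y_1, y_1)\<close> the sign is -1, so the paired terms double instead of
  cancelling; as \<open>[y_1, y_1] = x_1\<close>, the identity can be solved for
  \<open>\<phi> u (vx 1)\<close>.\<close>

lemma cocycle_vx1:
  assumes "u \<in> nf_part n a"
  shows "\<phi> u (vx 1) = 2 \<odot> nf_bracket n (\<phi> u (vy 1)) (vy 1) + 2 \<odot> \<phi> (nf_bracket n u (vy 1)) (vy 1)
    - \<phi> (vy 1) (vy 1) (X 1) \<odot> nf_bracket n u (vx 1)"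
proof -
  have y: "vy 1 \<in> nf_part n 1" by (simp add: vy_in_nf_part)
  have "nf_bracket n (vy 1) (vy 1) = (vx 1 :: 'f nf_vec)"
    using n by (subst nf_bracket_vy_vy1) auto
  moreover have "nf_bracket n u (\<phi> (vy 1) (vy 1)) = \<phi> (vy 1) (vy 1) (X 1) \<odot> nf_bracket n u (vx 1)"
    by (intro nf_bracket_even_right n cocycle_vy_vy) auto
  moreover have "nf_bracket n u (\<phi> (vy 1) (vy 1)) - nf_bracket n (\<phi> u (vy 1)) (vy 1)
      + super_sign 1 1 \<odot> nf_bracket n (\<phi> u (vy 1)) (vy 1)
      + \<phi> u (nf_bracket n (vy 1) (vy 1)) - \<phi> (nf_bracket n u (vy 1)) (vy 1)
      + super_sign 1 1 \<odot> \<phi> (nf_bracket n u (vy 1)) (vy 1) = 0"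
    using cocycle assms y unfolding even_2cocycles_def by blast
  ultimately have "\<phi> (vy 1) (vy 1) (X 1) \<odot> nf_bracket n u (vx 1) - nf_bracket n (\<phi> u (vy 1)) (vy 1)
      + super_sign 1 1 \<odot> nf_bracket n (\<phi> u (vy 1)) (vy 1)
      + \<phi> u (vx 1) - \<phi> (nf_bracket n u (vy 1)) (vy 1)
      + super_sign 1 1 \<odot> \<phi> (nf_bracket n u (vy 1)) (vy 1) = 0"
    by (simp only:)
  then show ?thesis
    by (simp add: super_sign_def fun_eq_iff nf_scale_apply algebra_simps)
qed

text \<open>For \<open>j \<ge> 2\<close> the product \<open>[y_1, y_j]\<close> vanishes, so one
  value of \<open>\<phi> u\<close> survives. At \<open>j = n + 1\<close> this value is
  \<open>\<phi> u 0 = 0\<close> and the identity becomes a constraint.\<close>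

lemma cocycle_symmetrized_vy_vy1:
  assumes "u \<in> nf_part n a" "j \<in> {2..n+1}"
  shows "\<phi> u (nf_bracket n (vy j) (vy 1))
    = (\<phi> (vy 1) (vy j) (X 1) - \<phi> (vy j) (vy 1) (X 1)) \<odot> nf_bracket n u (vx 1)"
proof -
  have y: "vy j \<in> nf_part n 1" "vy 1 \<in> nf_part n 1" using assms by (auto simp: vy_in_nf_part)
  have 0: "nf_bracket n (vy 1) (vy j) = (0 :: 'f nf_vec)"
    using assms y(1) by (subst nf_bracket_odd_right) (auto simp: n nf_unit_apply)
  have br: "nf_bracket n u (\<phi> (vy j) (vy 1)) = \<phi> (vy j) (vy 1) (X 1) \<odot> nf_bracket n u (vx 1)"
      "nf_bracket n u (\<phi> (vy 1) (vy j)) = \<phi> (vy 1) (vy j) (X 1) \<odot> nf_bracket n u (vx 1)"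
    by (intro nf_bracket_even_right n cocycle_vy_vy; use assms in auto)+
  show ?thesis
    using nf.even_2cocycle_symmetrized[OF cocycle assms(1) y]
    unfolding 0 br cocycle_zero(2)[OF assms(1)]
    by (simp add: super_sign_def fun_eq_iff nf_scale_apply algebra_simps)
qed

text \<open>\<open>[y_1, x_j]\<close> stays unevaluated: it is \<open>y_2\<close> for
  \<open>j = 1\<close> and 0 otherwise, and \<open>cocycle_vy\<close> treats the two cases
  separately.\<close>

lemma cocycle_symmetrized_vx_vy1:
  assumes "u \<in> nf_part n a" "j \<in> {1..n}"
  shows "(1/2) \<odot> \<phi> u (vy (j + 1)) + \<phi> u (nf_bracket n (vy 1) (vx j))
    = - (\<phi> (vx j) (vy 1) (Y 1) + \<phi> (vy 1) (vx j) (Y 1)) \<odot> nf_bracket n u (vy 1)"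
proof -
  have y: "vx j \<in> nf_part n 0" "vy 1 \<in> nf_part n 1"
    using assms by (auto simp: vx_in_nf_part vy_in_nf_part)
  have half: "\<phi> u (nf_bracket n (vx j) (vy 1)) = (1/2) \<odot> \<phi> u (vy (j + 1))"
    using assms by (subst nf_bracket_vx_vy1) (auto intro!: cocycle_scale vy_in_nf_part)
  have br: "nf_bracket n u (\<phi> (vx j) (vy 1)) = \<phi> (vx j) (vy 1) (Y 1) \<odot> nf_bracket n u (vy 1)"
      "nf_bracket n u (\<phi> (vy 1) (vx j)) = \<phi> (vy 1) (vx j) (Y 1) \<odot> nf_bracket n u (vy 1)"
    by (intro nf_bracket_odd_right n cocycle_vx_vy cocycle_vy_vx; use assms n in auto)+
  show ?thesis
    using nf.even_2cocycle_symmetrized[OF cocycle assms(1) y]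
    unfolding half br
    by (simp add: super_sign_def fun_eq_iff nf_scale_apply eq_neg_iff_add_eq_0 algebra_simps)
qed

text \<open>Brackets have no \<open>Y 1\<close> coordinate, so in \<open>cocycle_vx1\<close> at
  \<open>u = vy 1\<close> only twice \<open>\<phi>([y_1, y_1], y_1)\<close> contributes.\<close>

lemma cocycle_vy1_vx1_Y1: "\<phi> (vy 1) (vx 1) (Y 1) = 2 * \<phi> (vx 1) (vy 1) (Y 1)"
  using n cocycle_vx1[of "vy 1" 1] nf_bracket_vy_vy1[of 1 n, where 'a = 'f]
  by (simp add: vy_in_nf_part nf_bracket_Y nf_scale_apply)

lemma cocycle_vy:
  assumes u: "u \<in> nf_part n a" and j: "j \<in> {1..n}"
  shows "\<phi> u (vy (j + 1)) = (- (2 * \<phi> (vx j) (vy 1) (Y 1))) \<odot> nf_bracket n u (vy 1)"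
proof (cases "j = 1")
  case True
  have "nf_bracket n (vy 1) (vx 1) = (vy 2 :: 'f nf_vec)"
    using n by (subst nf_bracket_vy_vx1) auto
  \<comment> \<open>The left side collects 1/2 + 1 copies of \<open>\<phi> u (vy 2)\<close>; on the
    right \<open>cocycle_vy1_vx1_Y1\<close> triples the coefficient. Characteristic zero allows
    cancelling 3/2.\<close>
  then have "(3/2) * \<phi> u (vy 2) l = (3/2) * (- 2 * \<phi> (vx 1) (vy 1) (Y 1) * nf_bracket n u (vy 1) l)" for l
    using fun_cong[OF cocycle_symmetrized_vx_vy1[OF u, of 1], of l] n
    by (simp add: cocycle_vy1_vx1_Y1 nf_scale_apply algebra_simps)
  then have "\<phi> u (vy 2) l = - 2 * \<phi> (vx 1) (vy 1) (Y 1) * nf_bracket n u (vy 1) l" for l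
    unfolding mult_cancel_left by simp
  then show ?thesis
    by (simp add: True nf_scale_apply fun_eq_iff)
next
  case False
  with j have j2: "j \<in> {2..n}" by auto
  have x: "vx j \<in> nf_part n 0" using j by (auto simp: vx_in_nf_part)
  have 0: "nf_bracket n (vy 1) (vx j) = (0 :: 'f nf_vec)"
    using j2 x by (subst nf_bracket_even_right) (auto simp: n nf_unit_apply nf_scale_apply)
  \<comment> \<open>As \<open>[y_j, y_1] = x_j\<close>, this value is a multiple of
    \<open>[y_1, x_1]\<close>, which has no \<open>Y 1\<close> coordinate.\<close>
  have "\<phi> (vy 1) (vx j) (Y 1) = 0"
    using cocycle_symmetrized_vy_vy1[of "vy 1" 1 j] j2 nf_bracket_vy_vy1[of j n, where 'a = 'f]
    by (simp add: vy_in_nf_part nf_scale_apply nf_bracket_Y[OF n])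
  then have "\<phi> u (vy (j + 1)) l = - 2 * \<phi> (vx j) (vy 1) (Y 1) * nf_bracket n u (vy 1) l" for l
    using fun_cong[OF cocycle_symmetrized_vx_vy1[OF u j, unfolded 0 cocycle_zero(2)[OF u]], of l]
    by (simp add: nf_scale_apply field_simps)
  then show ?thesis
    by (simp add: nf_scale_apply fun_eq_iff)
qed

text \<open>Since \<open>[y_1, y_1] = x_1\<close>, the \<open>X 1\<close> coordinate isolates the
  scalar of \<open>cocycle_vy\<close>; this expresses the remaining unknown of
  \<open>cocycle_symmetrized_vy_vy1\<close> through \<open>\<phi>(x_j, y_1)\<close>.\<close>

lemma cocycle_vy1_vy_X1:
  assumes "j \<in> {1..n}"
  shows "\<phi> (vy 1) (vy (j + 1)) (X 1) = - (2 * \<phi> (vx j) (vy 1) (Y 1))"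
  using cocycle_vy[of "vy 1" 1 j] assms nf_bracket_vy_vy1[of 1 n, where 'a = 'f]
  by (simp add: vy_in_nf_part nf_scale_apply nf_unit_apply)

lemma cocycle_vx:
  assumes "u \<in> nf_part n a" "j \<in> {1..n-1}"
  shows "\<phi> u (vx (j + 1)) = (- (\<phi> (vy (j + 1)) (vy 1) (X 1) + 2 * \<phi> (vx j) (vy 1) (Y 1)))
    \<odot> nf_bracket n u (vx 1)"
proof -
  have "nf_bracket n (vy (j + 1)) (vy 1) = (vx (j + 1) :: 'f nf_vec)"
    using assms(2) by (subst nf_bracket_vy_vy1) auto
  moreover have "j + 1 \<in> {2..n+1}" "j \<in> {1..n}"
    using assms(2) by auto
  ultimately show ?thesis
    using cocycle_symmetrized_vy_vy1[OF assms(1), of "j + 1"] cocycle_vy1_vy_X1[of j] by simp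
qed

lemma cocycle_top_relation: "\<phi> (vx n) (vy 1) (Y 1) = - (\<phi> (vy (n + 1)) (vy 1) (X 1) / 2)"
proof -
  \<comment> \<open>For \<open>j = n + 1\<close> a scalar multiple of \<open>[y_1, x_1]\<close> is
    zero; its \<open>Y 2\<close> coordinate being 1 forces the scalar to vanish.\<close>
  have "nf_bracket n (vy 1) (vx 1) (Y 2) = (1 :: 'f)"
    using n by (simp add: nf_bracket_Y nf_unit_apply)
  moreover have "nf_bracket n (vy (n + 1)) (vy 1) = (0 :: 'f nf_vec)"
    by (subst nf_bracket_vy_vy1) auto
  moreover have "vy 1 \<in> nf_part n 1"
    by (simp add: vy_in_nf_part)
  ultimately have "\<phi> (vy 1) (vy (n + 1)) (X 1) = \<phi> (vy (n + 1)) (vy 1) (X 1)"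
    using fun_cong[OF cocycle_symmetrized_vy_vy1[of "vy 1" 1 "n + 1"], of "Y 2"] n
    by (simp add: cocycle_zero nf_scale_apply)
  then show ?thesis
    using cocycle_vy1_vy_X1[of n] n by (simp add: field_simps)
qed

end

section \<open>Assembling the normal form\<close>

theorem proposition4p8:
  fixes n :: nat
    and \<phi> :: "'f::field_char_0 nf_vec \<Rightarrow> 'f nf_vec \<Rightarrow> 'f nf_vec"
  assumes n: "1 \<le> n"
    and cocycle: "\<phi> \<in> even_2cocycles nf_scale (nf_part n) (nf_bracket n)"
  shows "\<exists>\<alpha> \<beta> :: nat \<Rightarrow> nat \<Rightarrow> 'f.
    (\<forall>j\<in>{1..n+1}. \<phi> (vy j) (vy 1) = (\<Sum>k=1..n. \<alpha> j k \<odot> vx k)) \<and>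
    (\<forall>j\<in>{1..n-1}. \<phi> (vx j) (vy 1) = (\<Sum>k=1..n+1. \<beta> j k \<odot> vy k)) \<and>
    \<phi> (vx n) (vy 1) = (- (\<alpha> (n+1) 1 / 2)) \<odot> vy 1 + (\<Sum>k=2..n+1. \<beta> n k \<odot> vy k) \<and>
    (\<forall>j\<in>{1..n-1}. \<phi> (vx j) (vx 1) =
       (- \<alpha> 1 1) \<odot> vx (j+1) + (\<Sum>k=1..n. (\<alpha> (j+1) k + 2 * \<beta> j k) \<odot> vx k)) \<and>
    \<phi> (vx n) (vx 1) = (\<Sum>k=2..n. (\<alpha> (n+1) k + 2 * \<beta> n k) \<odot> vx k) \<and>
    (\<forall>j\<in>{1..n-1}. \<phi> (vy j) (vx 1) =
       (2 * \<beta> j 1) \<odot> vy 1 + (- \<alpha> 1 1) \<odot> vy (j+1)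
       + (\<Sum>k=2..n+1. (\<alpha> j (k-1) + 2 * \<beta> j k) \<odot> vy k)) \<and>
    \<phi> (vy n) (vx 1) =
       (- \<alpha> (n+1) 1) \<odot> vy 1 + (- \<alpha> 1 1) \<odot> vy (n+1)
       + (\<Sum>k=2..n+1. (\<alpha> n (k-1) + 2 * \<beta> n k) \<odot> vy k) \<and>
    \<phi> (vy (n+1)) (vx 1) = (\<Sum>k=2..n+1. \<alpha> (n+1) (k-1) \<odot> vy k) \<and>
    (\<forall>i\<in>{1..n-1}. \<forall>j\<in>{1..n-1}.
       \<phi> (vx i) (vx (j+1)) = (- (\<alpha> (j+1) 1 + 2 * \<beta> j 1)) \<odot> vx (i+1)) \<and>
    (\<forall>i\<in>{1..n}. \<forall>j\<in>{1..n-1}.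
       \<phi> (vy i) (vx (j+1)) = (- (\<alpha> (j+1) 1 + 2 * \<beta> j 1)) \<odot> vy (i+1)) \<and>
    (\<forall>i\<in>{1..n}. \<forall>j\<in>{1..n-1}. \<phi> (vx i) (vy (j+1)) = (- \<beta> j 1) \<odot> vy (i+1)) \<and>
    (\<forall>i\<in>{1..n}. \<phi> (vx i) (vy (n+1)) = (\<alpha> (n+1) 1 / 2) \<odot> vy (i+1)) \<and>
    (\<forall>i\<in>{1..n}. \<forall>j\<in>{1..n-1}. \<phi> (vy i) (vy (j+1)) = (- (2 * \<beta> j 1)) \<odot> vx i) \<and>
    (\<forall>i\<in>{1..n}. \<phi> (vy i) (vy (n+1)) = \<alpha> (n+1) 1 \<odot> vx i) \<and>
    (\<forall>j\<in>{1..n-1}. \<phi> (vx n) (vx (j+1)) = 0) \<and>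
    (\<forall>j\<in>{1..n-1}. \<phi> (vy (n+1)) (vx (j+1)) = 0) \<and>
    (\<forall>j\<in>{1..n}. \<phi> (vy (n+1)) (vy (j+1)) = 0)"
proof -
  note One_nat_def [simp del]
  define \<alpha> where "\<alpha> j k = \<phi> (vy j) (vy 1) (X k)" for j k
  define \<beta> where "\<beta> j k = \<phi> (vx j) (vy 1) (Y k)" for j k
  note vxp = vx_in_nf_part[of _ n, where 'a = 'f] and vyp = vy_in_nf_part[of _ n, where 'a = 'f]
  note apply_simps = sum_vx_apply sum_vy_apply nf_scale_apply nf_unit_apply
  have top: "\<beta> n 1 = - (\<alpha> (n+1) 1 / 2)"
    unfolding \<alpha>_def \<beta>_def by (rule cocycle_top_relation[OF n cocycle])
  have Dy: "\<phi> (vy j) (vy 1) = (\<Sum>k=1..n. \<alpha> j k \<odot> vx k)" if "j \<in> {1..n+1}" for j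
    using cocycle_vy_vy[OF n cocycle that, of 1]
    by (intro nf_vec_eqI) (auto simp: apply_simps nf_part_even_iff \<alpha>_def)
  have Dx: "\<phi> (vx j) (vy 1) = (\<Sum>k=1..n+1. \<beta> j k \<odot> vy k)" if "j \<in> {1..n}" for j
    using cocycle_vx_vy[OF n cocycle that, of 1]
    by (intro nf_vec_eqI) (auto simp: apply_simps nf_part_odd_iff \<beta>_def)
  have Dxn: "\<phi> (vx n) (vy 1) = (- (\<alpha> (n+1) 1 / 2)) \<odot> vy 1 + (\<Sum>k=2..n+1. \<beta> n k \<odot> vy k)"
    using Dx[of n] n top by (simp add: sum.atLeast_Suc_atMost[of 1])
  \<comment> \<open>Here \<open>2 [x_j, y_1] = y_(j+1)\<close> produces the row
    \<open>\<alpha> (j+1)\<close>, and \<open>[y_k, y_1] = x_k\<close> turns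
    \<open>\<beta> j k\<close> into an \<open>x_k\<close> coefficient.\<close>
  have xx1: "\<phi> (vx j) (vx 1) = (if j \<le> n - 1 then (- \<alpha> 1 1) \<odot> vx (j+1) else 0)
      + (\<Sum>k=1..n. (\<alpha> (j+1) k + 2 * \<beta> j k) \<odot> vx k)" if "j \<in> {1..n}" for j
  proof -
    have "\<phi> ((1/2) \<odot> vy (j+1)) (vy 1) = (1/2) \<odot> \<phi> (vy (j+1)) (vy 1)"
      using that by (intro cocycle_scale[OF n cocycle, where a = 1 and b = 1] vyp) auto
    then show ?thesis
      using cocycle_vx1[OF n cocycle vxp, of j] that Dy[of "j+1"] Dx[of j]
      by (intro nf_vec_eqI)
        (auto simp: nf_bracket_vx_vy1 nf_bracket_vx_vx1 nf_bracket_X[OF n] nf_bracket_Y[OF n]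
          apply_simps \<alpha>_def[of 1 1])
  qed
  \<comment> \<open>Doubling \<open>[x_k, y_1]\<close> gives \<open>y_(k+1)\<close>, hence the
    shifted index \<open>k-1\<close>. For \<open>j = n + 1\<close> the products with
    \<open>y_1\<close> and \<open>x_1\<close> vanish, leaving only this sum.\<close>
  have yx1: "\<phi> (vy j) (vx 1) = (if j \<le> n then (- \<alpha> 1 1) \<odot> vy (j+1) + (\<Sum>k=1..n+1. (2 * \<beta> j k) \<odot> vy k) else 0)
      + (\<Sum>k=2..n+1. \<alpha> j (k-1) \<odot> vy k)" if "j \<in> {1..n+1}" for j
    using cocycle_vx1[OF n cocycle vyp, of j] that Dy[of j] Dx[of j] cocycle_zero[OF n cocycle vyp, of 1]
    by (intro nf_vec_eqI)
      (auto simp: nf_bracket_vy_vy1 nf_bracket_vy_vx1 nf_bracket_X[OF n] nf_bracket_Y[OF n]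
        apply_simps \<alpha>_def[of 1 1])
  have Vx: "\<phi> u (vx (j+1)) = (- (\<alpha> (j+1) 1 + 2 * \<beta> j 1)) \<odot> nf_bracket n u (vx 1)"
    if "u \<in> nf_part n a" "j \<in> {1..n-1}" for u a j
    unfolding \<alpha>_def \<beta>_def by (rule cocycle_vx[OF n cocycle that])
  have Vy: "\<phi> u (vy (j+1)) = (- (2 * \<beta> j 1)) \<odot> nf_bracket n u (vy 1)"
    if "u \<in> nf_part n a" "j \<in> {1..n}" for u a j
    unfolding \<beta>_def by (rule cocycle_vy[OF n cocycle that])
  show ?thesis
  proof (rule exI[of _ \<alpha>], rule exI[of _ \<beta>], intro conjI ballI)
    \<comment> \<open>By \<open>top\<close> the coefficient at \<open>k = 1\<close> is zero, so the
      sum starts at 2.\<close>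
    show "\<phi> (vx n) (vx 1) = (\<Sum>k=2..n. (\<alpha> (n+1) k + 2 * \<beta> n k) \<odot> vx k)"
      using xx1[of n] n top by (auto simp: sum.atLeast_Suc_atMost[of 1])
    show "\<phi> (vy n) (vx 1) = (- \<alpha> (n+1) 1) \<odot> vy 1 + (- \<alpha> 1 1) \<odot> vy (n+1)
        + (\<Sum>k=2..n+1. (\<alpha> n (k-1) + 2 * \<beta> n k) \<odot> vy k)"
      using n top by (subst yx1) (auto intro!: nf_vec_eqI simp: apply_simps)
    show "\<phi> (vy j) (vx 1) = (2 * \<beta> j 1) \<odot> vy 1 + (- \<alpha> 1 1) \<odot> vy (j+1)
        + (\<Sum>k=2..n+1. (\<alpha> j (k-1) + 2 * \<beta> j k) \<odot> vy k)" if "j \<in> {1..n-1}" for j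
      using that by (subst yx1) (auto intro!: nf_vec_eqI simp: apply_simps)
    show "\<phi> (vx j) (vx 1) = (- \<alpha> 1 1) \<odot> vx (j+1) + (\<Sum>k=1..n. (\<alpha> (j+1) k + 2 * \<beta> j k) \<odot> vx k)"
      if "j \<in> {1..n-1}" for j
      using that by (subst xx1) auto
    show "\<phi> (vy (n+1)) (vx 1) = (\<Sum>k=2..n+1. \<alpha> (n+1) (k-1) \<odot> vy k)"
      by (subst yx1) auto
    show "\<phi> (vx i) (vx (j+1)) = (- (\<alpha> (j+1) 1 + 2 * \<beta> j 1)) \<odot> vx (i+1)"
      if "i \<in> {1..n-1}" "j \<in> {1..n-1}" for i j
      using that by (subst Vx[OF vxp]) (auto simp: nf_bracket_vx_vx1)
    show "\<phi> (vy i) (vx (j+1)) = (- (\<alpha> (j+1) 1 + 2 * \<beta> j 1)) \<odot> vy (i+1)"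
      if "i \<in> {1..n}" "j \<in> {1..n-1}" for i j
      using that by (subst Vx[OF vyp]) (auto simp: nf_bracket_vy_vx1)
    show "\<phi> (vx i) (vy (j+1)) = (- \<beta> j 1) \<odot> vy (i+1)" if "i \<in> {1..n}" "j \<in> {1..n-1}" for i j
      using that by (subst Vy[OF vxp]) (auto simp: nf_bracket_vx_vy1)
    \<comment> \<open>This is \<open>Vy\<close> at \<open>j = n\<close>: by \<open>top\<close>,
      \<open>- \<beta> n 1\<close> equals \<open>\<alpha> (n+1) 1 / 2\<close>, with a plus sign,
      unlike the displayed English formula. The same holds for
      \<open>\<phi> (vy i) (vy (n+1))\<close> below.\<close>
    show "\<phi> (vx i) (vy (n+1)) = (\<alpha> (n+1) 1 / 2) \<odot> vy (i+1)" if "i \<in> {1..n}" for i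
      using that top by (subst Vy[OF vxp]) (auto simp: nf_bracket_vx_vy1)
    show "\<phi> (vy i) (vy (j+1)) = (- (2 * \<beta> j 1)) \<odot> vx i" if "i \<in> {1..n}" "j \<in> {1..n-1}" for i j
      using that by (subst Vy[OF vyp]) (auto simp: nf_bracket_vy_vy1)
    show "\<phi> (vy i) (vy (n+1)) = \<alpha> (n+1) 1 \<odot> vx i" if "i \<in> {1..n}" for i
      using that top by (subst Vy[OF vyp]) (auto simp: nf_bracket_vy_vy1)
    \<comment> \<open>The unlisted pairs vanish because \<open>[x_n, x_1]\<close>,
      \<open>[y_(n+1), x_1]\<close> and \<open>[y_(n+1), y_1]\<close> are zero.\<close>
    show "\<phi> (vx n) (vx (j+1)) = 0" if "j \<in> {1..n-1}" for j
      using that n by (subst Vx[OF vxp]) (auto simp: nf_bracket_vx_vx1)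
    show "\<phi> (vy (n+1)) (vx (j+1)) = 0" if "j \<in> {1..n-1}" for j
      using that n by (subst Vx[OF vyp]) (auto simp: nf_bracket_vy_vx1)
    show "\<phi> (vy (n+1)) (vy (j+1)) = 0" if "j \<in> {1..n}" for j
      using that by (subst Vy[OF vyp]) (auto simp: nf_bracket_vy_vy1)
  qed (use Dy Dx Dxn in auto)
qed

end
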